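(* Consider a pendulum tree with $n$ arms, connectivity matrix $S\in\{0,1\}^{n\times n}$, mass vector $m\in\mathbb{R}_+^n$, vector of lengths $\ell\in\mathbb{R}_+^n$ and gravitational acceleration $g>0$. For $\phi\in\mathbb{R}^n$ define the complex mass matrix $$\mathcal{M}(\phi)=\operatorname{diag}(e^{-\mathrm{i}\phi}\odot\ell)\,S^{T}\operatorname{diag}(m)\,S\,\operatorname{diag}(\ell\odot e^{\mathrm{i}\phi})\in\mathbb{C}^{n\times n},$$ and let $\mathcal{M}_{\rm re}(\phi)$ and $\mathcal{M}_{\rm im}(\phi)$ be its (entrywise) real and imaginary parts. Then $\mathcal{M}(\phi)$ is Hermitian and positive definite, and $\mathcal{M}_{\rm re}(\phi)$ is symmetric, positive definite and invertible. Moreover, if the vector of angles $\phi:\mathbb{R}\to\mathbb{R}^n$ and the vector of compression forces $\lambda:\mathbb{R}\to\mathbb{R}^n$ describe a motion of the pendulum (i.e. Newton's second law holds at all joints at all times), then $$\ddot{\phi}=\mathcal{M}_{\rm re}(\phi)^{-1}\Bigl[\mathcal{M}_{\rm im}(\phi)\,\dot{\phi}^2-g\cos(\phi)\odot\ell\odot[S^{T}m]\Bigr],$$ $$\lambda=g\sin(\phi)\odot[S^{T}m]-\ell^{-1}\odot\Bigl[\mathcal{M}_{\rm im}(\phi)\,\ddot{\phi}+\mathcal{M}_{\rm re}(\phi)\,\dot{\phi}^2\Bigr].$$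
   Context: Notation: $\mathbb{R}_+$ denotes the positive reals; functions and powers of vectors are taken entrywise (so $e^{\mathrm{i}\phi}$, $\cos(\phi)$, $\dot\phi^2$, $\ell^{-1}$ are vectors); $\odot$ is the elementwise product of column vectors; $\operatorname{diag}(a)$ is the diagonal matrix with the entries of the vector $a$ on its diagonal. The plane is identified with $\mathbb{C}$. Pendulum tree: a planar pendulum made of finitely many arms $1,\dots,n$ ($n\ge 1$) connected without cycles. Arm $k$ has length $\ell_k>0$, a near end, and a far end called its tip (or joint) $z_k\in\mathbb{C}$. Exactly one arm $r$ has its near end attached to the fixed pivot at $0\in\mathbb{C}$; every other arm $k$ has its near end attached to the tip $z_{p(k)}$ of another arm $p(k)$ (its parent), and iterating $p$ from any arm eventually reaches $r$. Several arms may share a parent. All arms rotate freely (without friction). A point mass $m_k>0$ sits at $z_k$ and there is no other mass. The angle of arm $k$ with respect to the positive real axis is $\phi_k\in\mathbb{R}$, so $z_r=\ell_r e^{\mathrm{i}\phi_r}$ and $z_k=z_{p(k)}+\ell_k e^{\mathrm{i}\phi_k}$ for $k\ne r$. Connectivity matrix: the matrix $S\in\{0,1\}^{n\times n}$ for which $z=S[\ell\odot e^{\mathrm{i}\phi}]$ for all $\phi$; explicitly $S_{kj}=1$ if arm $j$ lies on the path from the pivot to $z_k$ (that is, $j=k$ or $j$ is obtained from $k$ by iterating $p$), and $S_{kj}=0$ otherwise. Forces and motion: arm $k$ carries a real compression force $\lambda_k$, acting on its tip $z_k$ as $\lambda_k e^{\mathrm{i}\phi_k}$ and on its near end as $-\lambda_k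 e^{\mathrm{i}\phi_k}$. The total force on joint $k$ is therefore $F_k=-\mathrm{i}g m_k+\lambda_k e^{\mathrm{i}\phi_k}-\sum_{j:\,p(j)=k}\lambda_j e^{\mathrm{i}\phi_j}$. A motion consists of a twice differentiable $\phi:\mathbb{R}\to\mathbb{R}^n$ and $\lambda:\mathbb{R}\to\mathbb{R}^n$ such that Newton's second law $m_k\ddot z_k=F_k$ holds for all $k=1,\dots,n$ and all times. Dots denote time derivatives. *)

theory Defs
  imports "HOL-Analysis.Analysis"
begin

section \<open>Matrices\<close>

text \<open>Products and powers of vectors of type \<open>'a ^ 'n\<close> are entrywise in the library, so
  \<open>x * y\<close> is the elementwise product and \<open>x\<^sup>2\<close> the entrywise square.\<close>

definition diag :: "'a::zero ^ 'n \<Rightarrow> 'a ^ 'n ^ 'n" where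
  "diag a = (\<chi> i j. if i = j then a $ i else 0)"

definition hermitian :: "complex ^ 'n ^ 'n \<Rightarrow> bool" where
  "hermitian A \<longleftrightarrow> transpose (map_matrix cnj A) = A"

definition symmetric :: "'a ^ 'n ^ 'n \<Rightarrow> bool" where
  "symmetric A \<longleftrightarrow> transpose A = A"

definition pos_def_complex :: "complex ^ 'n ^ 'n \<Rightarrow> bool" where
  "pos_def_complex A \<longleftrightarrow>
    (\<forall>x. x \<noteq> 0 \<longrightarrow>
      (let q = (\<Sum>i\<in>UNIV. cnj (x $ i) * (A *v x) $ i) in q \<in> \<real> \<and> 0 < Re q))"

definition pos_def_real :: "real ^ 'n ^ 'n \<Rightarrow> bool" where
  "pos_def_real A \<longleftrightarrow> (\<forall>x. x \<noteq> 0 \<longrightarrow> 0 < x \<bullet> (A *v x))"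


section \<open>Pendulum trees\<close>

text \<open>The arms are the elements of a finite type \<open>'n\<close>.  The tree is given by its parent map
  \<open>p\<close>, where \<open>p k = None\<close> says that arm \<open>k\<close> hangs from the fixed pivot.\<close>

definition parent_rel :: "('n \<Rightarrow> 'n option) \<Rightarrow> ('n \<times> 'n) set" where
  "parent_rel p = {(k, q). p k = Some q}"

definition pendulum_tree :: "('n \<Rightarrow> 'n option) \<Rightarrow> bool" where
  "pendulum_tree p \<longleftrightarrow>
    (\<exists>r. (\<forall>k. p k = None \<longleftrightarrow> k = r) \<and> (\<forall>k. (k, r) \<in> (parent_rel p)\<^sup>*))"

definition connectivity_matrix :: "('n \<Rightarrow> 'n option) \<Rightarrow> real ^ 'n ^ 'n" where
  "connectivity_matrix p = (\<chi> k j. if (k, j) \<in> (parent_rel p)\<^sup>* then 1 else 0)"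

definition joint_positions ::
    "('n \<Rightarrow> 'n option) \<Rightarrow> real ^ 'n \<Rightarrow> real ^ 'n \<Rightarrow> complex ^ 'n \<Rightarrow> bool" where
  "joint_positions p len \<theta> z \<longleftrightarrow>
    (\<forall>k. z $ k = (case p k of None \<Rightarrow> 0 | Some q \<Rightarrow> z $ q) + complex_of_real (len $ k) * cis (\<theta> $ k))"

text \<open>The defining property of the connectivity matrix: it expresses the joint positions
  linearly in the arms.  In particular the joint positions exist and are unique.\<close>

lemma pendulum_tree_acyclic:
  assumes "pendulum_tree p"
  shows "(k, k) \<notin> (parent_rel p)\<^sup>+"
proof
  assume cyc: "(k, k) \<in> (parent_rel p)\<^sup>+"
  obtain r where r: "p r = None" and reach: "(k, r) \<in> (parent_rel p)\<^sup>*"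
    using assms unfolding pendulum_tree_def by blast
  from reach have "(r, k) \<in> (parent_rel p)\<^sup>+"
  proof (induction rule: rtrancl_induct)
    case base
    show ?case by (rule cyc)
  next
    case (step y y')
    from tranclD[OF step.IH] obtain w where "(y, w) \<in> parent_rel p" "(w, k) \<in> (parent_rel p)\<^sup>*"
      by blast
    moreover from this step.hyps(2) have "w = y'"
      by (simp add: parent_rel_def)
    ultimately show ?case
      using cyc by (meson rtrancl_trancl_trancl)
  qed
  then show False
    using r by (auto dest!: tranclD simp: parent_rel_def)
qed

lemma joint_positions_iff:
  assumes tree: "pendulum_tree p"
  shows "joint_positions p len \<theta> z \<longleftrightarrow>
    z = map_matrix complex_of_real (connectivity_matrix p) *v
          (\<chi> k. complex_of_real (len $ k) * cis (\<theta> $ k))" (is "_ \<longleftrightarrow> z = ?w")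
proof -
  define a where "a = (\<lambda>j. complex_of_real (len $ j) * cis (\<theta> $ j))"
  have w: "?w $ k = (\<Sum>j | (k, j) \<in> (parent_rel p)\<^sup>*. a j)" for k
  proof -
    have "?w $ k = (\<Sum>j\<in>UNIV. if (k, j) \<in> (parent_rel p)\<^sup>* then a j else 0)"
      unfolding matrix_vector_mult_def connectivity_matrix_def a_def
      by (auto intro!: sum.cong)
    then show ?thesis by (simp add: sum.If_cases)
  qed
  have anc_root: "{j. (k, j) \<in> (parent_rel p)\<^sup>*} = {k}" if "p k = None" for k
    using that by (auto elim: converse_rtranclE simp: parent_rel_def)
  have anc_step: "{j. (k, j) \<in> (parent_rel p)\<^sup>*} = insert k {j. (q, j) \<in> (parent_rel p)\<^sup>*}"
    if "p k = Some q" for k q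
    using that by (auto elim: converse_rtranclE intro: converse_rtrancl_into_rtrancl
        simp: parent_rel_def)
  have w_rec: "?w $ k = (case p k of None \<Rightarrow> 0 | Some q \<Rightarrow> ?w $ q) + a k" for k
  proof (cases "p k")
    case None
    then show ?thesis by (simp only: w anc_root option.case) simp
  next
    case (Some q)
    have "(q, k) \<notin> (parent_rel p)\<^sup>*"
    proof
      assume "(q, k) \<in> (parent_rel p)\<^sup>*"
      moreover have "(k, q) \<in> parent_rel p" using Some by (simp add: parent_rel_def)
      ultimately have "(k, k) \<in> (parent_rel p)\<^sup>+" by (meson rtrancl_into_trancl2)
      with pendulum_tree_acyclic[OF tree] show False by blast
    qed
    then show ?thesis
      unfolding w by (simp add: Some anc_step[OF Some])
  qed
  obtain r where r: "p r = None" "\<And>k. p k = None \<longleftrightarrow> k = r"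
      and reach: "\<And>k. (k, r) \<in> (parent_rel p)\<^sup>*"
    using tree unfolding pendulum_tree_def by blast
  show ?thesis
  proof
    assume "joint_positions p len \<theta> z"
    then have z: "z $ k = (case p k of None \<Rightarrow> 0 | Some q \<Rightarrow> z $ q) + a k" for k
      by (simp add: joint_positions_def a_def)
    have "z $ k = ?w $ k" for k
      using reach[of k]
    proof (induction rule: converse_rtrancl_induct)
      case base
      show ?case by (subst z, subst w_rec) (simp add: r)
    next
      case (step y q)
      then have "p y = Some q" by (simp add: parent_rel_def)
      then show ?case using step.IH by (subst z, subst w_rec) simp
    qed
    then show "z = ?w" by (simp add: vec_eq_iff)
  next
    assume "z = ?w"
    then show "joint_positions p len \<theta> z"
      unfolding joint_positions_def using w_rec unfolding a_def by blast
  qed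
qed


section \<open>Motions\<close>

definition ddt :: "(real \<Rightarrow> 'a::real_normed_vector) \<Rightarrow> real \<Rightarrow> 'a" where
  "ddt f t = vector_derivative f (at t)"

definition twice_differentiable :: "(real \<Rightarrow> 'a::real_normed_vector) \<Rightarrow> bool" where
  "twice_differentiable f \<longleftrightarrow>
    (\<forall>t. f differentiable at t) \<and> (\<forall>t. ddt f differentiable at t)"

definition joint_force ::
    "('n::finite \<Rightarrow> 'n option) \<Rightarrow> real ^ 'n \<Rightarrow> real \<Rightarrow> real ^ 'n \<Rightarrow> real ^ 'n \<Rightarrow> 'n \<Rightarrow> complex" where
  "joint_force p m g \<theta> c k =
    - (\<i> * complex_of_real (g * m $ k)) + complex_of_real (c $ k) * cis (\<theta> $ k)
    - (\<Sum>j | p j = Some k. complex_of_real (c $ j) * cis (\<theta> $ j))"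

definition pendulum_motion ::
    "('n::finite \<Rightarrow> 'n option) \<Rightarrow> real ^ 'n \<Rightarrow> real ^ 'n \<Rightarrow> real \<Rightarrow>
      (real \<Rightarrow> real ^ 'n) \<Rightarrow> (real \<Rightarrow> real ^ 'n) \<Rightarrow> bool" where
  "pendulum_motion p m len g \<phi> lam \<longleftrightarrow>
    twice_differentiable \<phi> \<and>
    (\<exists>z. (\<forall>t. joint_positions p len (\<phi> t) (z t)) \<and>
         (\<forall>t k. complex_of_real (m $ k) * ddt (ddt (\<lambda>s. z s $ k)) t
                  = joint_force p m g (\<phi> t) (lam t) k))"


section \<open>The mass matrix\<close>

definition mass_matrix ::
    "('n::finite \<Rightarrow> 'n option) \<Rightarrow> real ^ 'n \<Rightarrow> real ^ 'n \<Rightarrow> real ^ 'n \<Rightarrow> complex ^ 'n ^ 'n" where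
  "mass_matrix p m len \<theta> =
    (let S = map_matrix complex_of_real (connectivity_matrix p) in
      diag (\<chi> k. cis (- \<theta> $ k) * complex_of_real (len $ k)) ** transpose S
        ** diag (\<chi> k. complex_of_real (m $ k)) ** S
        ** diag (\<chi> k. complex_of_real (len $ k) * cis (\<theta> $ k)))"

abbreviation mass_matrix_re ::
    "('n::finite \<Rightarrow> 'n option) \<Rightarrow> real ^ 'n \<Rightarrow> real ^ 'n \<Rightarrow> real ^ 'n \<Rightarrow> real ^ 'n ^ 'n" where
  "mass_matrix_re p m len \<theta> \<equiv> map_matrix Re (mass_matrix p m len \<theta>)"

abbreviation mass_matrix_im ::
    "('n::finite \<Rightarrow> 'n option) \<Rightarrow> real ^ 'n \<Rightarrow> real ^ 'n \<Rightarrow> real ^ 'n \<Rightarrow> real ^ 'n ^ 'n" where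
  "mass_matrix_im p m len \<theta> \<equiv> map_matrix Im (mass_matrix p m len \<theta>)"

end

theory Submission
  imports Defs
begin

text \<open>Multiplying Newton's law by \<open>transpose S\<close> sums the forces over each subtree, where the internal
  compression forces cancel. Rotating the result by \<open>cis (- \<phi>)\<close> gives the complex equation
  \<open>M (\<i> \<phi>'' - \<phi>'\<^sup>2) = len * (lam - \<i> g cis (- \<phi>) (transpose S m))\<close>, whose real part yields the
  compression forces and whose imaginary part the accelerations. Definiteness of \<open>M\<close> comes from
  \<open>x\<^sup>* M x = (\<Sum>k. m k * |(S y) k|\<^sup>2)\<close> with \<open>y = len * cis \<theta> * x\<close> and the injectivity of \<open>S\<close>.\<close>

section \<open>The connectivity matrix: recursion along parents, telescoping, injectivity\<close>

lemma rtrancl_parent_rel_iff: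
  "(k, i) \<in> (parent_rel p)\<^sup>* \<longleftrightarrow>
    k = i \<or> (case p k of None \<Rightarrow> False | Some q \<Rightarrow> (q, i) \<in> (parent_rel p)\<^sup>*)"
  by (auto elim: converse_rtranclE intro: converse_rtrancl_into_rtrancl
      simp: parent_rel_def split: option.splits)

text \<open>The path of \<open>k\<close> is the path of its parent together with \<open>k\<close>
  itself. Acyclicity keeps the two summands from both being 1 when \<open>k = i\<close>.\<close>

lemma connectivity_matrix_rec:
  assumes "pendulum_tree p"
  shows "connectivity_matrix p $ k $ i =
    (case p k of None \<Rightarrow> 0 | Some q \<Rightarrow> connectivity_matrix p $ q $ i) + (if k = i then 1 else 0)"
proof -
  have "(q, i) \<notin> (parent_rel p)\<^sup>*" if "p k = Some q" "k = i" for q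
  proof
    assume "(q, i) \<in> (parent_rel p)\<^sup>*"
    moreover have "(k, q) \<in> parent_rel p" using that(1) by (simp add: parent_rel_def)
    ultimately have "(k, i) \<in> (parent_rel p)\<^sup>+" by (meson rtrancl_into_trancl2)
    with pendulum_tree_acyclic[OF assms] that(2) show False by blast
  qed
  then show ?thesis
    using rtrancl_parent_rel_iff[of k i p] unfolding connectivity_matrix_def
    by (auto split: option.splits)
qed

text \<open>Newton's law involves the matrix that subtracts from each arm the sum over its children;
  summing over a subtree telescopes, i.e. that matrix is inverse to \<open>transpose S\<close>.\<close>
lemma connectivity_matrix_telescope:
  fixes f :: "'n::finite \<Rightarrow> complex"
  assumes tree: "pendulum_tree p"
  shows "(\<Sum>k\<in>UNIV. complex_of_real (connectivity_matrix p $ k $ i) *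
            (f k - (\<Sum>j | p j = Some k. f j))) = f i"
proof -
  let ?S = "\<lambda>k. complex_of_real (connectivity_matrix p $ k $ i)"
  let ?P = "\<lambda>j. case p j of None \<Rightarrow> 0 | Some q \<Rightarrow> ?S q"
  have S: "?S j = ?P j + (if j = i then 1 else 0)" for j
    by (subst connectivity_matrix_rec[OF tree]) (auto split: option.splits)
  have "(\<Sum>k\<in>UNIV. ?S k * (\<Sum>j | p j = Some k. f j))
      = (\<Sum>k\<in>UNIV. \<Sum>j\<in>UNIV. if p j = Some k then ?S k * f j else 0)"
    by (simp add: sum_distrib_left sum.If_cases)
  \<comment> \<open>Exchanging the sums attributes each \<open>f j\<close> to the unique parent of
    \<open>j\<close>; the root, having none, gets weight 0.\<close>
  also have "\<dots> = (\<Sum>j\<in>UNIV. \<Sum>k\<in>UNIV. if p j = Some k then ?S k * f j else 0)"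
    by (rule sum.swap)
  also have "\<dots> = (\<Sum>j\<in>UNIV. ?P j * f j)"
    by (intro sum.cong refl) (auto split: option.splits)
  finally have "(\<Sum>k\<in>UNIV. ?S k * (f k - (\<Sum>j | p j = Some k. f j)))
      = (\<Sum>k\<in>UNIV. (?S k - ?P k) * f k)"
    by (simp add: algebra_simps sum_subtractf)
  also have "\<dots> = (\<Sum>k\<in>UNIV. (if k = i then 1 else 0) * f k)"
    by (intro sum.cong refl) (simp add: S)
  also have "\<dots> = (\<Sum>k\<in>UNIV. if k = i then f k else 0)"
    by (intro sum.cong refl) simp
  also have "\<dots> = f i" by simp
  finally show ?thesis .
qed

lemma connectivity_matrix_inj:
  fixes y :: "complex ^ 'n::finite"
  assumes tree: "pendulum_tree p"
    and "map_matrix complex_of_real (connectivity_matrix p) *v y = 0"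
  shows "y = 0"
proof -
  \<comment> \<open>Read \<open>y\<close> in polar form as the arms of a degenerate pendulum with all joints at the pivot.\<close>
  define len where "len = (\<chi> k. cmod (y $ k))"
  define \<theta> where "\<theta> = (\<chi> k. Arg (y $ k))"
  have y: "complex_of_real (len $ k) * cis (\<theta> $ k) = y $ k" for k
    unfolding len_def \<theta>_def using rcis_cmod_Arg[of "y $ k"] by (simp add: rcis_def)
  then have "joint_positions p len \<theta> 0"
    using assms by (simp add: joint_positions_iff vec_lambda_eta)
  then show ?thesis
    \<comment> \<open>With every joint at 0, each clause of the recursion reduces to
      \<open>0 = 0 + y $ k\<close>.\<close>
    unfolding joint_positions_def y by (simp add: vec_eq_iff split: option.splits) (metis not_None_eq)
qed

section \<open>Entries, quadratic form and definiteness of the mass matrix\<close>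

lemma mass_matrix_nth:
  "mass_matrix p m len \<theta> $ i $ j =
    (\<Sum>k\<in>UNIV. complex_of_real (m $ k)
      * cnj (complex_of_real (connectivity_matrix p $ k $ i * len $ i) * cis (\<theta> $ i))
      * (complex_of_real (connectivity_matrix p $ k $ j * len $ j) * cis (\<theta> $ j)))"
proof -
  have L: "(diag a ** B) $ i $ j = a $ i * B $ i $ j"
    and R: "(B ** diag a) $ i $ j = B $ i $ j * a $ j"
    for a and B :: "complex ^ 'a ^ 'a" and i j
    by (simp_all add: matrix_matrix_mult_def diag_def if_distrib if_distribR
        sum.delta cong: if_cong)
  show ?thesis
    \<comment> \<open>Only the product with \<open>S\<close> becomes a sum, over joints; the
      diagonal factors merely scale rows (\<open>L\<close>) or columns (\<open>R\<close>).\<close>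
    unfolding mass_matrix_def Let_def
    unfolding R matrix_matrix_mult_def[of _ "map_matrix complex_of_real (connectivity_matrix p)"]
    by (simp add: R L transpose_def sum_distrib_right sum_distrib_left cis_cnj mult_ac)
qed

text \<open>The entries have the weighted Gram form \<open>m k * cnj (b k i) * b k j\<close> summed
  over \<open>k\<close>; since the masses are real, conjugation swaps \<open>i\<close> and
  \<open>j\<close>.\<close>

lemma mass_matrix_cnj:
  "cnj (mass_matrix p m len \<theta> $ i $ j) = mass_matrix p m len \<theta> $ j $ i"
  by (simp add: mass_matrix_nth mult_ac)

text \<open>The sums stay nested, following the factors of the matrix: the inner one applies
  \<open>S\<close> to the arms, the outer one \<open>transpose S\<close>. Both the quadratic form
  and Newton's law need this shape.\<close>

lemma mass_matrix_mult_nth: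
  "(mass_matrix p m len \<theta> *v x) $ i =
    complex_of_real (len $ i) * cis (- \<theta> $ i) *
    (\<Sum>k\<in>UNIV. complex_of_real (connectivity_matrix p $ k $ i) * (complex_of_real (m $ k) *
      (\<Sum>j\<in>UNIV. complex_of_real (connectivity_matrix p $ k $ j) *
        (complex_of_real (len $ j) * cis (\<theta> $ j) * x $ j))))"
  unfolding matrix_vector_mult_def mass_matrix_nth
  apply (simp add: sum_distrib_left sum_distrib_right cis_cnj)
  apply (subst sum.swap)
  apply (simp add: mult_ac)
  done

lemma mass_matrix_form:
  "(\<Sum>i\<in>UNIV. cnj (x $ i) * (mass_matrix p m len \<theta> *v x) $ i) =
    complex_of_real (\<Sum>k\<in>UNIV. m $ k * (cmod ((map_matrix complex_of_real (connectivity_matrix p) *v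
      (\<chi> j. complex_of_real (len $ j) * cis (\<theta> $ j) * x $ j)) $ k))\<^sup>2)"
proof -
  define y where "y = (\<chi> j. complex_of_real (len $ j) * cis (\<theta> $ j) * x $ j)"
  let ?S = "\<lambda>k i. complex_of_real (connectivity_matrix p $ k $ i)"
  let ?u = "\<lambda>k. \<Sum>j\<in>UNIV. ?S k j * y $ j"
  \<comment> \<open>The prefactor \<open>len i * cis (- \<theta> i)\<close> turns
    \<open>cnj (x i)\<close> into \<open>cnj (y i)\<close>.\<close>
  have "(\<Sum>i\<in>UNIV. cnj (x $ i) * (mass_matrix p m len \<theta> *v x) $ i)
      = (\<Sum>i\<in>UNIV. \<Sum>k\<in>UNIV. complex_of_real (m $ k) * (?u k * cnj (?S k i * y $ i)))"
    unfolding mass_matrix_mult_nth y_def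
    by (simp add: sum_distrib_left[of _ _ UNIV] cis_cnj mult_ac)
  also have "\<dots> = (\<Sum>k\<in>UNIV. \<Sum>i\<in>UNIV. complex_of_real (m $ k) * (?u k * cnj (?S k i * y $ i)))"
    by (rule sum.swap)
  also have "\<dots> = (\<Sum>k\<in>UNIV. complex_of_real (m $ k) * (?u k * cnj (?u k)))"
    by (simp only: sum_distrib_left cnj_sum)
  also have "\<dots> = complex_of_real (\<Sum>k\<in>UNIV. m $ k * (cmod (?u k))\<^sup>2)"
    by (simp only: complex_norm_square[symmetric] of_real_sum of_real_mult of_real_power)
  finally show ?thesis
    by (simp add: matrix_vector_mult_def y_def)
qed

lemma pos_def_complex_mass_matrix:
  assumes tree: "pendulum_tree p" and m: "\<forall>k. 0 < m $ k" and len: "\<forall>k. 0 < len $ k"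
  shows "pos_def_complex (mass_matrix p m len \<theta>)"
  unfolding pos_def_complex_def Let_def mass_matrix_form
proof (intro allI impI conjI)
  fix x :: "complex ^ 'a" assume "x \<noteq> 0"
  let ?y = "\<chi> j. complex_of_real (len $ j) * cis (\<theta> $ j) * x $ j"
  let ?u = "map_matrix complex_of_real (connectivity_matrix p) *v ?y"
  obtain j where "x $ j \<noteq> 0" using \<open>x \<noteq> 0\<close> by (auto simp: vec_eq_iff)
  then have "?y $ j \<noteq> 0" using len[rule_format, of j] by simp
  then have "?u \<noteq> 0" using connectivity_matrix_inj[OF tree, of ?y] by (metis zero_index)
  then obtain k where "?u $ k \<noteq> 0" by (auto simp: vec_eq_iff)
  then have "0 < m $ k * (cmod (?u $ k))\<^sup>2" using m by simp
  moreover have "0 \<le> m $ i * (cmod (?u $ i))\<^sup>2" for i using m[rule_format, of i] by simp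
  ultimately have "0 < (\<Sum>k\<in>UNIV. m $ k * (cmod (?u $ k))\<^sup>2)"
    by (intro sum_pos2[of _ k]) auto
  then show "0 < Re (complex_of_real (\<Sum>k\<in>UNIV. m $ k * (cmod (?u $ k))\<^sup>2))"
    by simp
qed simp

text \<open>On a real vector \<open>x\<close>, the real part of the complex quadratic form is the
  quadratic form of the real part of \<open>A\<close>.\<close>

lemma pos_def_real_map_matrix_Re:
  fixes A :: "complex ^ 'n ^ 'n"
  assumes "pos_def_complex A"
  shows "pos_def_real (map_matrix Re A)"
  unfolding pos_def_real_def
proof (intro allI impI)
  fix x :: "real ^ 'n" assume "x \<noteq> 0"
  then have "(\<chi> i. complex_of_real (x $ i)) \<noteq> 0" by (auto simp: vec_eq_iff)
  then have "0 < Re (\<Sum>i\<in>UNIV. cnj ((\<chi> i. complex_of_real (x $ i)) $ i) *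
      (A *v (\<chi> i. complex_of_real (x $ i))) $ i)"
    using assms unfolding pos_def_complex_def Let_def by blast
  then show "0 < x \<bullet> (map_matrix Re A *v x)"
    by (simp add: inner_vec_def matrix_vector_mult_def)
qed

text \<open>A kernel vector has quadratic form 0, so the kernel is trivial, which suffices for a
  square matrix.\<close>

lemma pos_def_real_imp_invertible:
  fixes A :: "real ^ 'n ^ 'n"
  assumes "pos_def_real A"
  shows "invertible A"
proof -
  have "x = 0" if "A *v x = 0" for x
    using assms that unfolding pos_def_real_def by (metis inner_zero_right less_irrefl)
  then show ?thesis
    by (simp add: invertible_left_inverse matrix_left_invertible_ker)
qed

section \<open>Joint accelerations and the complex equation of motion\<close>

lemma has_vector_derivative_cis:
  assumes "(f has_vector_derivative f') (at t)"
  shows "((\<lambda>s. cis (f s)) has_vector_derivative \<i> * complex_of_real f' * cis (f t)) (at t)"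
proof -
  have "((\<lambda>s. \<i> * complex_of_real (f s)) has_vector_derivative \<i> * complex_of_real f') (at t)"
    using assms by (intro has_vector_derivative_mult_right has_vector_derivative_of_real)
      (simp add: has_real_derivative_iff_has_vector_derivative)
  from field_vector_diff_chain_at[OF this DERIV_exp]
  show ?thesis by (simp add: cis_conv_exp o_def)
qed

text \<open>Each arm contributes a tangential term with \<phi>'' and, from the product of two
  factors \<open>\<i>\<close>, a centripetal term with -\<phi>'^2. The coefficients \<open>a\<close>
  will be entries of \<open>S\<close> times lengths.\<close>

lemma ddt_ddt_arms:
  fixes \<phi> :: "real \<Rightarrow> real ^ 'n::finite" and a :: "'n \<Rightarrow> complex"
  assumes "twice_differentiable \<phi>"
  shows "ddt (ddt (\<lambda>s. \<Sum>j\<in>UNIV. a j * cis (\<phi> s $ j))) t =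
    (\<Sum>j\<in>UNIV. a j * cis (\<phi> t $ j) *
      (\<i> * complex_of_real (ddt (ddt \<phi>) t $ j) - complex_of_real ((ddt \<phi> t $ j)\<^sup>2)))"
proof -
  have d1: "((\<lambda>s. \<phi> s $ j) has_vector_derivative ddt \<phi> t $ j) (at t)"
    and d2: "((\<lambda>s. ddt \<phi> s $ j) has_vector_derivative ddt (ddt \<phi>) t $ j) (at t)" for j t
    using assms unfolding twice_differentiable_def ddt_def
    by (auto intro!: bounded_linear.has_vector_derivative[OF bounded_linear_vec_nth]
        simp: vector_derivative_works[symmetric])
  have "ddt (\<lambda>s. \<Sum>j\<in>UNIV. a j * cis (\<phi> s $ j)) =
      (\<lambda>s. \<Sum>j\<in>UNIV. a j * (\<i> * complex_of_real (ddt \<phi> s $ j) * cis (\<phi> s $ j)))"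
    \<comment> \<open>Unfolding only at this function keeps \<open>ddt \<phi>\<close> folded for the
      second differentiation.\<close>
    unfolding ddt_def[of "\<lambda>s. \<Sum>j\<in>UNIV. a j * cis (\<phi> s $ j)"]
    by (intro ext vector_derivative_at has_vector_derivative_sum has_vector_derivative_mult_right
        has_vector_derivative_cis d1)
  moreover have "((\<lambda>s. a j * (\<i> * complex_of_real (ddt \<phi> s $ j) * cis (\<phi> s $ j)))
      has_vector_derivative a j * cis (\<phi> t $ j) *
      (\<i> * complex_of_real (ddt (ddt \<phi>) t $ j) - complex_of_real ((ddt \<phi> t $ j)\<^sup>2))) (at t)" for j
  proof -
    have "((\<lambda>s. \<i> * complex_of_real (ddt \<phi> s $ j)) has_vector_derivative
        \<i> * complex_of_real (ddt (ddt \<phi>) t $ j)) (at t)"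
      using d2 by (intro has_vector_derivative_mult_right has_vector_derivative_of_real)
        (simp add: has_real_derivative_iff_has_vector_derivative)
    from has_vector_derivative_mult_right[OF
        has_vector_derivative_mult[OF this has_vector_derivative_cis[OF d1]], of "a j"]
    show ?thesis by (simp add: algebra_simps power2_eq_square)
  qed
  ultimately show ?thesis
    unfolding ddt_def[of "ddt (\<lambda>s. \<Sum>j\<in>UNIV. a j * cis (\<phi> s $ j))"]
    by (simp only:) (intro vector_derivative_at has_vector_derivative_sum)
qed

text \<open>The rotation by \<open>cis (- \<phi>)\<close> takes the direction of arm
  \<open>i\<close> to the real axis, so the compression force enters only the real part.\<close>

lemma pendulum_motion_complex:
  fixes \<phi> lam :: "real \<Rightarrow> real ^ 'n::finite"
  assumes tree: "pendulum_tree p" and motion: "pendulum_motion p m len g \<phi> lam"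
  shows "(mass_matrix p m len (\<phi> t) *v
      (\<chi> j. \<i> * complex_of_real (ddt (ddt \<phi>) t $ j) - complex_of_real ((ddt \<phi> t $ j)\<^sup>2))) $ i =
    complex_of_real (len $ i) * (complex_of_real (lam t $ i)
      - \<i> * complex_of_real (g * (transpose (connectivity_matrix p) *v m) $ i) * cis (- \<phi> t $ i))"
proof -
  let ?S = "\<lambda>k i. complex_of_real (connectivity_matrix p $ k $ i)"
  let ?a = "\<lambda>j. \<i> * complex_of_real (ddt (ddt \<phi>) t $ j) - complex_of_real ((ddt \<phi> t $ j)\<^sup>2)"
  let ?f = "\<lambda>j. complex_of_real (lam t $ j) * cis (\<phi> t $ j)"
  obtain z where twice: "twice_differentiable \<phi>"
    and z: "\<And>t. joint_positions p len (\<phi> t) (z t)"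
    and newton: "\<And>k. complex_of_real (m $ k) * ddt (ddt (\<lambda>s. z s $ k)) t
        = joint_force p m g (\<phi> t) (lam t) k"
    using motion unfolding pendulum_motion_def by blast
  have "(\<lambda>s. z s $ k) = (\<lambda>s. \<Sum>j\<in>UNIV. ?S k j * complex_of_real (len $ j) * cis (\<phi> s $ j))" for k
    using z by (simp add: joint_positions_iff[OF tree] matrix_vector_mult_def mult_ac)
  then have ddz: "ddt (ddt (\<lambda>s. z s $ k)) t =
      (\<Sum>j\<in>UNIV. ?S k j * (complex_of_real (len $ j) * cis (\<phi> t $ j) * ?a j))" for k
    by (simp only: ddt_ddt_arms[OF twice]) (simp only: mult.assoc)
  \<comment> \<open>The inner sum of the matrix product is the acceleration of joint
    \<open>k\<close>, so Newton's law replaces it, times the mass, by the force.\<close>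
  have "(mass_matrix p m len (\<phi> t) *v (\<chi> j. ?a j)) $ i =
      complex_of_real (len $ i) * cis (- \<phi> t $ i) *
      (\<Sum>k\<in>UNIV. ?S k i * joint_force p m g (\<phi> t) (lam t) k)"
    unfolding newton[symmetric] ddz mass_matrix_mult_nth by simp
  \<comment> \<open>The compression forces form the telescoping difference; gravity collects the
    mass of the subtree at \<open>i\<close>.\<close>
  also have "(\<Sum>k\<in>UNIV. ?S k i * joint_force p m g (\<phi> t) (lam t) k) =
      (\<Sum>k\<in>UNIV. ?S k i * (?f k - (\<Sum>j | p j = Some k. ?f j)))
      - (\<Sum>k\<in>UNIV. \<i> * (?S k i * complex_of_real (g * m $ k)))"
    unfolding sum_subtractf[symmetric] joint_force_def
    by (intro sum.cong refl) (simp add: algebra_simps)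
  also have "(\<Sum>k\<in>UNIV. \<i> * (?S k i * complex_of_real (g * m $ k))) =
      \<i> * complex_of_real (g * (transpose (connectivity_matrix p) *v m) $ i)"
    by (simp add: matrix_vector_mult_def transpose_def sum_distrib_left mult_ac)
  finally show ?thesis
    \<comment> \<open>What survives is \<open>lam i * cis (\<phi> i)\<close>, whose phase cancels
      against the prefactor.\<close>
    unfolding connectivity_matrix_telescope[OF tree]
    by (simp add: algebra_simps cis_mult)
qed

theorem theorem3p3:
  fixes p :: "'n::finite \<Rightarrow> 'n option"
    and m len :: "real ^ 'n"
    and g :: real
  assumes "pendulum_tree p"
    and "\<forall>k. 0 < m $ k"
    and "\<forall>k. 0 < len $ k"
    and "0 < g"
  shows "(\<forall>\<theta>.
      hermitian (mass_matrix p m len \<theta>) \<and>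
      pos_def_complex (mass_matrix p m len \<theta>) \<and>
      symmetric (mass_matrix_re p m len \<theta>) \<and>
      pos_def_real (mass_matrix_re p m len \<theta>) \<and>
      invertible (mass_matrix_re p m len \<theta>)) \<and>
    (\<forall>(\<phi> :: real \<Rightarrow> real ^ 'n) (lam :: real \<Rightarrow> real ^ 'n).
      pendulum_motion p m len g \<phi> lam \<longrightarrow>
      (\<forall>t.
        ddt (ddt \<phi>) t =
          matrix_inv (mass_matrix_re p m len (\<phi> t)) *v
            (mass_matrix_im p m len (\<phi> t) *v (ddt \<phi> t)\<^sup>2
              - g *\<^sub>R ((\<chi> k. cos (\<phi> t $ k)) * len * (transpose (connectivity_matrix p) *v m))) \<and>
        lam t =
          g *\<^sub>R ((\<chi> k. sin (\<phi> t $ k)) * (transpose (connectivity_matrix p) *v m))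
            - (\<chi> k. inverse (len $ k)) *
                (mass_matrix_im p m len (\<phi> t) *v ddt (ddt \<phi>) t
                  + mass_matrix_re p m len (\<phi> t) *v (ddt \<phi> t)\<^sup>2)))"
proof (intro conjI allI impI)
  fix \<theta>
  show "hermitian (mass_matrix p m len \<theta>)"
    by (simp add: hermitian_def transpose_def vec_eq_iff mass_matrix_cnj)
  have "Re (mass_matrix p m len \<theta> $ j $ i) = Re (mass_matrix p m len \<theta> $ i $ j)" for i j
    by (metis complex_cnj mass_matrix_cnj complex.sel(1) cnj.simps(1))
  then show "symmetric (mass_matrix_re p m len \<theta>)"
    by (simp add: symmetric_def transpose_def vec_eq_iff)
  show pd: "pos_def_complex (mass_matrix p m len \<theta>)"
    using assms by (simp add: pos_def_complex_mass_matrix)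
  show "pos_def_real (mass_matrix_re p m len \<theta>)"
    by (rule pos_def_real_map_matrix_Re[OF pd])
  then show "invertible (mass_matrix_re p m len \<theta>)"
    by (rule pos_def_real_imp_invertible)
next
  fix \<phi> lam :: "real \<Rightarrow> real ^ 'n" and t
  assume motion: "pendulum_motion p m len g \<phi> lam"
  let ?R = "mass_matrix_re p m len (\<phi> t)" and ?I = "mass_matrix_im p m len (\<phi> t)"
  let ?\<mu> = "transpose (connectivity_matrix p) *v m"
  let ?v = "(ddt \<phi> t)\<^sup>2" and ?a = "ddt (ddt \<phi>) t"
  note eq = pendulum_motion_complex[OF assms(1) motion, of t]
  have sq: "?v $ j = (ddt \<phi> t $ j)\<^sup>2" for j
    by (simp add: power2_eq_square)
  \<comment> \<open>Here \<open>\<i> * cis (- \<phi>)\<close> has real part sin \<phi> and imaginary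
    part cos \<phi>, the source of both gravity terms.\<close>
  have re: "(?I *v ?a) $ i + (?R *v ?v) $ i
      = len $ i * (g * sin (\<phi> t $ i) * ?\<mu> $ i - lam t $ i)" for i
    using arg_cong[OF eq, of Re i]
    by (simp add: matrix_vector_mult_def sq sum_subtractf sum_negf algebra_simps)
  have im: "(?R *v ?a) $ i - (?I *v ?v) $ i = - (g * cos (\<phi> t $ i) * len $ i * ?\<mu> $ i)" for i
    using arg_cong[OF eq, of Im i]
    by (simp add: matrix_vector_mult_def sq sum_subtractf sum_negf algebra_simps)
  have inv: "invertible ?R"
    using assms by (simp add: pos_def_complex_mass_matrix pos_def_real_imp_invertible
        pos_def_real_map_matrix_Re)
  have "?R *v ?a = ?I *v ?v - g *\<^sub>R ((\<chi> k. cos (\<phi> t $ k)) * len * ?\<mu>)"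
    unfolding vec_eq_iff using im by (simp add: algebra_simps)
  \<comment> \<open>\<open>matrix_inv\<close> is a choice; invertibility supplies the witness that
    makes it a genuine inverse.\<close>
  moreover have "matrix_inv ?R ** ?R = mat 1"
    using someI_ex[OF inv[unfolded invertible_def]] by (simp add: matrix_inv_def)
  ultimately show "?a = matrix_inv ?R *v (?I *v ?v - g *\<^sub>R ((\<chi> k. cos (\<phi> t $ k)) * len * ?\<mu>))"
    by (metis matrix_vector_mul_assoc matrix_vector_mul_lid)
  \<comment> \<open>The real part is solved for \<open>lam\<close>, dividing by the positive
    length.\<close>
  have "lam t $ i = g * (sin (\<phi> t $ i) * ?\<mu> $ i)
      - inverse (len $ i) * ((?I *v ?a) $ i + (?R *v ?v) $ i)" for i
    using assms(3)[rule_format, of i] unfolding re by (simp add: field_simps)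
  then show "lam t = g *\<^sub>R ((\<chi> k. sin (\<phi> t $ k)) * ?\<mu>)
      - (\<chi> k. inverse (len $ k)) * (?I *v ?a + ?R *v ?v)"
    by (simp add: vec_eq_iff)
qed

end
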